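(* Let $L$ be a $\mathbb{Z}$-colorable link with $\mathrm{mincol}_{\mathbb{Z}}(L)=4$. Then there exist a diagram $D$ of $L$ and a $\mathbb{Z}$-coloring $\gamma$ on $D$ such that $\mathrm{Im}(\gamma)=\{0,1,2,3\}$.
   Context: An arc of a regular link diagram $D$ is a maximal unbroken piece of the diagram. A $\mathbb{Z}$-coloring on $D$ is a map $\gamma:\{\text{arcs of } D\}\to\mathbb{Z}$ such that at each crossing with over arc $a$ and under arcs $b,c$ one has $2\gamma(a)=\gamma(b)+\gamma(c)$; it is trivial if all arcs get the same color. A link is $\mathbb{Z}$-colorable if some diagram of it admits a non-trivial $\mathbb{Z}$-coloring. For a $\mathbb{Z}$-colorable link $L$, $\mathrm{mincol}_{\mathbb{Z}}(L)$ is the minimum of $|\mathrm{Im}(\gamma)|$ over all non-trivial $\mathbb{Z}$-colorings $\gamma$ on all diagrams of $L$. *)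

theory Defs
  imports "HOL-Analysis.Analysis"
begin

text \<open>Points of 3-space; the diagram is the projection to the first two coordinates,
  the third coordinate is the height (used to decide over/under).\<close>
type_synonym pt = "real \<times> real \<times> real"

definition proj :: "pt \<Rightarrow> real \<times> real" where
  "proj p = (fst p, fst (snd p))"

definition height :: "pt \<Rightarrow> real" where
  "height p = snd (snd p)"

definition polygonal_link :: "pt set \<Rightarrow> bool" where
  "polygonal_link K \<longleftrightarrow> K \<noteq> {} \<and>
     (\<exists>S. finite S \<and> K = (\<Union>(a, b)\<in>S. closed_segment a b)) \<and>
     (\<forall>C\<in>components K. C homeomorphic sphere (0::complex) 1)"

definition ambient_isotopic :: "pt set \<Rightarrow> pt set \<Rightarrow> bool" where
  "ambient_isotopic K K' \<longleftrightarrow>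
     (\<exists>H :: real \<times> pt \<Rightarrow> pt.
        continuous_on ({0..1} \<times> UNIV) H \<and>
        (\<forall>t\<in>{0..1}. \<exists>g. homeomorphism UNIV UNIV (\<lambda>x. H (t, x)) g) \<and>
        (\<forall>x. H (0, x) = x) \<and>
        (\<lambda>x. H (1, x)) ` K = K')"

definition double_points :: "pt set \<Rightarrow> (real \<times> real) set" where
  "double_points K = {proj x | x. x \<in> K \<and> (\<exists>y\<in>K. y \<noteq> x \<and> proj y = proj x)}"

text \<open>Regular position: at most two points over each point of the plane, finitely many
  double points, and (for some segment decomposition) no vertex lies over a double point,
  so that all crossings are transverse crossings of two straight pieces.\<close>
definition regular_position :: "pt set \<Rightarrow> bool" where
  "regular_position K \<longleftrightarrow> polygonal_link K \<and>
     (\<forall>x\<in>K. \<forall>y\<in>K. \<forall>z\<in>K. proj x = proj y \<and> proj y = proj z \<longrightarrow> x = y \<or> y = z \<or> x = z) \<and>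
     finite (double_points K) \<and>
     (\<exists>S. finite S \<and> K = (\<Union>(a, b)\<in>S. closed_segment a b) \<and>
        (\<forall>(a, b)\<in>S. \<forall>x\<in>K. (proj x = proj a \<longrightarrow> x = a) \<and> (proj x = proj b \<longrightarrow> x = b)))"

text \<open>A diagram of the link K: the projection of a link in regular position that is
  ambient isotopic to K (the diagram is represented by such a link).\<close>
definition diagram_of :: "pt set \<Rightarrow> pt set \<Rightarrow> bool" where
  "diagram_of K D \<longleftrightarrow> regular_position D \<and> ambient_isotopic K D"

definition under_points :: "pt set \<Rightarrow> pt set" where
  "under_points K = {u\<in>K. \<exists>w\<in>K. proj w = proj u \<and> height u < height w}"

definition arcs :: "pt set \<Rightarrow> pt set set" where
  "arcs K = components (K - under_points K)"

text \<open>Z-coloring: at each crossing (over point o, under point u) the over arc a and the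
  two under arcs b, c (the arcs ending at u; b = c is allowed) satisfy 2 a = b + c.\<close>
definition zcoloring :: "pt set \<Rightarrow> (pt set \<Rightarrow> int) \<Rightarrow> bool" where
  "zcoloring D \<gamma> \<longleftrightarrow>
     (\<forall>u\<in>D. \<forall>w\<in>D. proj w = proj u \<and> height u < height w \<longrightarrow>
        (\<exists>a\<in>arcs D. w \<in> a \<and>
           (\<exists>b c. {A\<in>arcs D. u \<in> closure A} = {b, c} \<and> 2 * \<gamma> a = \<gamma> b + \<gamma> c)))"

definition nontrivial_coloring :: "pt set \<Rightarrow> (pt set \<Rightarrow> int) \<Rightarrow> bool" where
  "nontrivial_coloring D \<gamma> \<longleftrightarrow> (\<exists>A\<in>arcs D. \<exists>B\<in>arcs D. \<gamma> A \<noteq> \<gamma> B)"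

definition Z_colorable :: "pt set \<Rightarrow> bool" where
  "Z_colorable K \<longleftrightarrow>
     (\<exists>D \<gamma>. diagram_of K D \<and> zcoloring D \<gamma> \<and> nontrivial_coloring D \<gamma>)"

definition mincol_Z :: "pt set \<Rightarrow> nat" where
  "mincol_Z K = (LEAST n. \<exists>D \<gamma>. diagram_of K D \<and> zcoloring D \<gamma> \<and>
                     nontrivial_coloring D \<gamma> \<and> card (\<gamma> ` arcs D) = n)"

end

theory Submission
  imports Defs
begin

text \<open>Take a diagram whose coloring has exactly four colors \<open>p < q < r < s\<close>. Call a set \<open>W\<close> of colors
  dominant if at each crossing either both under arcs have colors in \<open>W\<close>, and then so has the over
  arc, or neither has. The strands with colors in a dominant set form a sublink that passes over
  all the others; it can be lifted and moved away, which splits the link and yields a coloring with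
  two colors. So neither \<open>{q}\<close> nor \<open>{r}\<close> is dominant, and a violating crossing exhibits \<open>q, r, s\<close>,
  respectively \<open>p, q, r\<close>, as arithmetic progressions. Hence \<open>p, q, r, s\<close> is one, and an affine
  change of colors turns it into \<open>0, 1, 2, 3\<close>.\<close>

subsection \<open>Components and removed points\<close>

lemma homeomorphism_UNIV_closure_image:
  assumes "homeomorphism UNIV UNIV h g"
  shows "closure (h ` X) = h ` closure X"
proof (rule closure_bij_homeomorphic_image_eq[of h UNIV UNIV g UNIV UNIV])
  show "bij_betw h UNIV UNIV"
    using assms unfolding homeomorphism_def by (intro bij_betw_byWitness[where f' = g]) auto
qed (use assms in \<open>simp_all add: homeomorphism_def\<close>)

lemma image_in_components:
  assumes hom: "homeomorphism UNIV UNIV h g" and C: "C \<in> components S"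
  shows "h ` C \<in> components (h ` S)"
proof -
  have gh: "\<And>x. g (h x) = x" "\<And>x. h (g x) = x"
    using hom by (simp_all add: homeomorphism_def)
  have con: "connected (h ` C)"
    by (rule connected_continuous_image[OF continuous_on_subset[OF homeomorphism_cont1[OF hom] subset_UNIV]
          in_components_connected[OF C]])
  have sub: "h ` C \<subseteq> h ` S" "h ` C \<noteq> {}"
    using in_components_subset[OF C] in_components_nonempty[OF C] by blast+
  then obtain D where D: "D \<in> components (h ` S)" "h ` C \<subseteq> D"
    using exists_component_superset[OF sub(1) _ con] by blast
  have "connected (g ` D)"
    by (rule connected_continuous_image[OF continuous_on_subset[OF homeomorphism_cont2[OF hom] subset_UNIV]
          in_components_connected[OF D(1)]])
  moreover have "g ` D \<subseteq> g ` h ` S"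
    using in_components_subset[OF D(1)] by (rule image_mono)
  then have "g ` D \<subseteq> S" by (simp only: image_image gh image_ident)
  moreover have "g ` h ` C \<subseteq> g ` D" using D(2) by (rule image_mono)
  then have CD: "C \<subseteq> g ` D" by (simp only: image_image gh image_ident)
  then have "C \<inter> g ` D \<noteq> {}" using in_components_nonempty[OF C] by blast
  ultimately have "g ` D \<subseteq> C" using components_maximal[OF C] by simp
  then have "h ` g ` D \<subseteq> h ` C" by (rule image_mono)
  then have "D \<subseteq> h ` C" by (simp only: image_image gh image_ident)
  then show ?thesis using D by (simp add: subset_antisym)
qed

lemma components_homeomorphic_image:
  assumes "homeomorphism UNIV UNIV h g"
  shows "components (h ` S) = (`) h ` components S"
proof (intro equalityI subsetI)
  fix C assume C: "C \<in> components (h ` S)"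
  have gh: "\<And>x. g (h x) = x" "\<And>x. h (g x) = x"
    using assms by (auto simp: homeomorphism_def)
  have "g ` C \<in> components (g ` h ` S)"
    by (rule image_in_components[OF homeomorphism_symD[OF assms] C])
  then have "g ` C \<in> components S" by (simp add: image_image gh)
  moreover have "C = h ` g ` C" by (simp add: image_image gh)
  ultimately show "C \<in> (`) h ` components S" by blast
next
  fix C assume "C \<in> (`) h ` components S"
  then show "C \<in> components (h ` S)" using image_in_components[OF assms] by auto
qed

section \<open>Finitely many connected pieces after deleting finitely many points\<close>

lemma closure_Union_finite:
  assumes "finite F"
  shows "closure (\<Union>F) = \<Union>(closure ` F)"
  using assms by (induction) auto

text \<open>Every component contains a nonempty member of \<open>F\<close>, and distinct components
  are disjoint, so choosing one such member for each component is injective into the finite set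
  \<open>F\<close>.\<close>

lemma finite_components_Union:
  assumes "finite F" "\<And>C. C \<in> F \<Longrightarrow> connected C"
  shows "finite (components (\<Union>F))"
proof -
  have "\<exists>C\<in>F. C \<subseteq> X \<and> C \<noteq> {}" if X: "X \<in> components (\<Union>F)" for X
  proof -
    obtain x where "x \<in> X" using in_components_nonempty[OF X] by blast
    then obtain C where "C \<in> F" "x \<in> C" using in_components_subset[OF X] by blast
    then show ?thesis
      using components_maximal[OF X, of C] assms(2) \<open>x \<in> X\<close> by blast
  qed
  then obtain f where f: "\<And>X. X \<in> components (\<Union>F) \<Longrightarrow> f X \<in> F \<and> f X \<subseteq> X \<and> f X \<noteq> {}"
    by metis
  have "inj_on f (components (\<Union>F))"
  proof (rule inj_onI)
    fix X Y assume "X \<in> components (\<Union>F)" "Y \<in> components (\<Union>F)" "f X = f Y"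
    then show "X = Y" using f[of X] f[of Y] components_nonoverlap[of X "\<Union>F" Y] by blast
  qed
  moreover have "f ` components (\<Union>F) \<subseteq> F" using f by blast
  ultimately show ?thesis using assms(1) inj_on_finite by blast
qed

text \<open>Injectivity makes each deleted point of the curve correspond to one parameter
  \<open>t\<close>, which cuts the interval \<open>I\<close> into the parts below and above
  \<open>t\<close>. The induction therefore ranges over arbitrary intervals.\<close>

lemma interval_image_diff_finite:
  fixes f :: "real \<Rightarrow> 'a::topological_space"
  assumes "inj f" "continuous_on UNIV f" "finite U" "is_interval I"
  shows "\<exists>F. finite F \<and> (\<forall>C\<in>F. connected C) \<and> f ` I - U = \<Union>F"
  using assms(3,4)
proof (induction U arbitrary: I)
  case empty
  have "connected (f ` I)"
    by (rule connected_continuous_image[OF continuous_on_subset[OF assms(2)] is_interval_connected[OF empty]]) simp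
  then show ?case by (intro exI[of _ "{f ` I}"]) auto
next
  case (insert p U)
  show ?case
  proof (cases "p \<in> f ` I")
    case False
    then have "f ` I - insert p U = f ` I - U" by blast
    then show ?thesis using insert.IH[OF insert.prems] by simp
  next
    case True
    then obtain t where t: "p = f t" by blast
    have "is_interval (I \<inter> {..<t})" "is_interval (I \<inter> {t<..})"
      using insert.prems by (auto intro!: is_interval_Int simp: is_interval_1)
    from insert.IH[OF this(1)] insert.IH[OF this(2)] obtain F G where
      FG: "finite F" "\<forall>C\<in>F. connected C" "f ` (I \<inter> {..<t}) - U = \<Union>F"
      "finite G" "\<forall>C\<in>G. connected C" "f ` (I \<inter> {t<..}) - U = \<Union>G" by metis
    have "I - {t} = I \<inter> {..<t} \<union> I \<inter> {t<..}" by auto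
    moreover have "f ` I - {p} = f ` (I - {t})"
      using image_set_diff[OF assms(1), of I "{t}"] t by simp
    ultimately have "f ` I - {p} = f ` (I \<inter> {..<t}) \<union> f ` (I \<inter> {t<..})"
      by (simp only: image_Un)
    then have "f ` I - insert p U = (f ` (I \<inter> {..<t}) - U) \<union> (f ` (I \<inter> {t<..}) - U)"
      by (metis Diff_insert2 Un_Diff)
    then have "f ` I - insert p U = \<Union>(F \<union> G)"
      by (simp only: FG(3,6) Union_Un_distrib)
    then show ?thesis using FG by (intro exI[of _ "F \<union> G"]) auto
  qed
qed

lemma closed_segment_diff_finite:
  fixes a b :: "'a::real_normed_vector"
  assumes "finite U"
  shows "\<exists>F. finite F \<and> (\<forall>C\<in>F. connected C) \<and> closed_segment a b - U = \<Union>F"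
\<comment> \<open>A degenerate segment is a single point and its parametrization is not injective,
  so it is treated apart.\<close>
proof (cases "a = b")
  case True
  then have "connected (closed_segment a b - U)"
    by (cases "a \<in> U") (auto simp: insert_Diff_if)
  then show ?thesis by (intro exI[of _ "{closed_segment a b - U}"]) auto
next
  case False
  let ?f = "\<lambda>t::real. a + t *\<^sub>R (b - a)"
  have "inj ?f" using False by (auto intro!: injI)
  moreover have "continuous_on UNIV ?f" by (intro continuous_intros)
  moreover have "closed_segment a b = ?f ` {0..1}"
    unfolding closed_segment_def by (force simp: algebra_simps)
  ultimately show ?thesis
    using interval_image_diff_finite[of ?f U "{0..1}"] assms by (simp add: is_interval_cc)
qed

text \<open>With the under points as \<open>U\<close> this gives the finiteness of the set of
  arcs.\<close>

lemma finite_components_segments_diff_finite: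
  fixes S :: "('a::real_normed_vector \<times> 'a) set"
  assumes "finite S" "finite U"
  shows "finite (components ((\<Union>(a, b)\<in>S. closed_segment a b) - U))"
proof -
  have "\<forall>s. \<exists>F. finite F \<and> (\<forall>C\<in>F. connected C) \<and> closed_segment (fst s) (snd s) - U = \<Union>F"
    using closed_segment_diff_finite[OF assms(2)] by blast
  then obtain F where F: "\<And>s. finite (F s)" "\<And>s C. C \<in> F s \<Longrightarrow> connected C"
    "\<And>s. closed_segment (fst s) (snd s) - U = \<Union>(F s)" by metis
  have "(\<Union>(a, b)\<in>S. closed_segment a b) - U = (\<Union>s\<in>S. closed_segment (fst s) (snd s) - U)"
    by (auto simp: case_prod_unfold)
  also have "\<dots> = \<Union>(\<Union>s\<in>S. F s)" using F(3) by auto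
  finally have eq: "(\<Union>(a, b)\<in>S. closed_segment a b) - U = \<Union>(\<Union>s\<in>S. F s)" .
  show ?thesis
    unfolding eq by (rule finite_components_Union) (use assms(1) F(1,2) in blast)+
qed

text \<open>Refilling some of the points removed from a curve merges pieces, so no point
  becomes adjacent to more pieces than before.\<close>
lemma components_adjacent_refill:
  fixes D :: "'a::t1_space set"
  assumes "finite U" "finite (components (D - U))" "U0 \<subseteq> U" "u \<in> U0"
    and bc: "{A \<in> components (D - U). u \<in> closure A} = {b, c}"
  shows "\<exists>b' c'. {A \<in> components (D - U0). u \<in> closure A} = {b', c'}"
proof -
  have sub: "\<exists>Q\<in>components (D - U0). P \<subseteq> Q" if "P \<in> components (D - U)" for P
    using exists_component_superset[of P "D - U0"] that assms(3)
      in_components_connected[OF that] in_components_nonempty[OF that] in_components_subset[OF that]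
    by blast
  have b: "b \<in> components (D - U)" "u \<in> closure b" and c: "c \<in> components (D - U)" "u \<in> closure c"
    using bc by blast+
  obtain b' where b': "b' \<in> components (D - U0)" "b \<subseteq> b'" using sub b by blast
  obtain c' where c': "c' \<in> components (D - U0)" "c \<subseteq> c'" using sub c by blast
  have "A = b' \<or> A = c'" if A: "A \<in> components (D - U0)" "u \<in> closure A" for A
  proof -
    \<comment> \<open>Deleting the finite set \<open>U\<close> from \<open>A\<close> keeps
      \<open>u\<close> a limit point. As \<open>A - U\<close> is covered by the finitely many old
      pieces inside \<open>A\<close>, one of them has \<open>u\<close> in its closure; it is
      \<open>b\<close> or \<open>c\<close>, so \<open>A\<close> meets \<open>b'\<close> or
      \<open>c'\<close>.\<close>
    have "u \<notin> A" using in_components_subset[OF A(1)] assms(4) by blast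
    then have "u islimpt A" using A(2) by (simp add: closure_def)
    then have "u islimpt (U \<union> (A - U))"
      by (rule islimpt_subset) blast
    then have "u islimpt (A - U)" by (simp only: islimpt_Un_finite[OF assms(1)])
    then have "u \<in> closure (A - U)" by (simp add: closure_def)
    moreover have "A - U \<subseteq> \<Union>{P \<in> components (D - U). P \<subseteq> A}"
    proof
      fix x assume x: "x \<in> A - U"
      then have "x \<in> D - U" using in_components_subset[OF A(1)] by blast
      then obtain P where P: "P \<in> components (D - U)" "x \<in> P"
        using Union_components[of "D - U"] by blast
      then have "P \<subseteq> A"
        using components_maximal[OF A(1), of P] x assms(3) in_components_connected[OF P(1)]
          in_components_subset[OF P(1)] by blast
      then show "x \<in> \<Union>{P \<in> components (D - U). P \<subseteq> A}" using P by blast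
    qed
    ultimately have "u \<in> closure (\<Union>{P \<in> components (D - U). P \<subseteq> A})"
      using closure_mono[of "A - U"] by blast
    then obtain P where P: "P \<in> components (D - U)" "P \<subseteq> A" "u \<in> closure P"
      using closure_Union_finite[of "{P \<in> components (D - U). P \<subseteq> A}"] assms(2) by auto
    then have "P \<in> {b, c}" unfolding bc[symmetric] by simp
    then have "A \<inter> b' \<noteq> {} \<or> A \<inter> c' \<noteq> {}"
      using P b' c' in_components_nonempty[OF P(1)] by blast
    then show ?thesis
      using components_nonoverlap[OF A(1) b'(1)] components_nonoverlap[OF A(1) c'(1)] by blast
  qed
  moreover have "u \<in> closure b'" "u \<in> closure c'"
    using b(2) c(2) closure_mono[OF b'(2)] closure_mono[OF c'(2)] by blast+
  ultimately have "{A \<in> components (D - U0). u \<in> closure A} = {b', c'}"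
    using b'(1) c'(1) by blast
  then show ?thesis by blast
qed

subsection \<open>Splitting off a sublink that lies above the rest\<close>

lemma ambient_isotopic_trans:
  assumes "ambient_isotopic K L" "ambient_isotopic L M"
  shows "ambient_isotopic K M"
proof -
  obtain H :: "real \<times> pt \<Rightarrow> pt" where H: "continuous_on ({0..1} \<times> UNIV) H"
    "\<forall>t\<in>{0..1}. \<exists>g. homeomorphism UNIV UNIV (\<lambda>x. H (t, x)) g"
    "\<forall>x. H (0, x) = x" "(\<lambda>x. H (1, x)) ` K = L"
    using assms(1) unfolding ambient_isotopic_def by (elim exE conjE) (rule that, assumption+)
  obtain G :: "real \<times> pt \<Rightarrow> pt" where G: "continuous_on ({0..1} \<times> UNIV) G"
    "\<forall>t\<in>{0..1}. \<exists>g. homeomorphism UNIV UNIV (\<lambda>x. G (t, x)) g"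
    "\<forall>x. G (0, x) = x" "(\<lambda>x. G (1, x)) ` L = M"
    using assms(2) unfolding ambient_isotopic_def by (elim exE conjE) (rule that, assumption+)
  \<comment> \<open>The isotopies are composed time by time instead of run one after the other, so
    no rescaling of time or gluing arises.\<close>
  define F where "F = (\<lambda>z. G (fst z, H z))"
  have "continuous_on ({0..1} \<times> UNIV) F"
    unfolding F_def
    by (rule continuous_on_compose2[OF G(1) continuous_on_Pair[OF continuous_on_fst[OF continuous_on_id] H(1)]])
      auto
  moreover have "\<exists>g. homeomorphism UNIV UNIV (\<lambda>x. F (t, x)) g" if t: "t \<in> {0..1}" for t
  proof -
    obtain h where h: "homeomorphism UNIV UNIV (\<lambda>x. H (t, x)) h"
      using bspec[OF H(2) t] by (rule exE)
    obtain g where g: "homeomorphism UNIV UNIV (\<lambda>x. G (t, x)) g"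
      using bspec[OF G(2) t] by (rule exE)
    from homeomorphism_compose[OF h g] show ?thesis
      unfolding F_def o_def fst_conv by (rule exI[of _ "\<lambda>x. h (g x)"])
  qed
  moreover have "F (0, x) = x" for x by (simp only: F_def fst_conv H(3)[rule_format] G(3)[rule_format])
  moreover have "(\<lambda>x. F (1, x)) ` K = M"
    by (simp add: F_def H(4)[symmetric] G(4)[symmetric] image_image)
  ultimately show ?thesis
    unfolding ambient_isotopic_def by (intro exI[of _ F] conjI ballI allI)
qed

section \<open>The vertical direction and a Urysohn function monotone along it\<close>

definition up :: pt where "up = (0, 0, 1)"

lemma proj_eq_iff: "proj x = proj y \<longleftrightarrow> (\<exists>r. y = x + r *\<^sub>R up)"
proof
  assume "proj x = proj y"
  then show "\<exists>r. y = x + r *\<^sub>R up"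
    by (intro exI[of _ "height y - height x"]) (auto simp: proj_def height_def up_def prod_eq_iff)
qed (auto simp: proj_def up_def)

lemma proj_add_up [simp]: "proj (x + r *\<^sub>R up) = proj x"
  by (simp add: proj_def up_def)

lemma height_add_up [simp]: "height (x + r *\<^sub>R up) = height x + r"
  by (simp add: height_def up_def)

text \<open>The distance of the moved point to \<open>q\<close> is the distance of \<open>x\<close>
  to the point of \<open>D\<close> obtained by sliding \<open>q\<close> back. The factor
  \<open>c\<close> stands for a sign: \<open>1\<close> serves sets closed under moving down,
  \<open>-1\<close> those closed under moving up.\<close>

lemma infdist_add_up_mono:
  fixes D :: "pt set"
  assumes "D \<noteq> {}" "\<And>q r. q \<in> D \<Longrightarrow> r \<ge> 0 \<Longrightarrow> q - (r * c) *\<^sub>R up \<in> D" "0 \<le> r"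
  shows "infdist x D \<le> infdist (x + (r * c) *\<^sub>R up) D"
proof -
  have "infdist x D \<le> dist (x + (r * c) *\<^sub>R up) q" if "q \<in> D" for q
  proof -
    have "infdist x D \<le> dist x (q - (r * c) *\<^sub>R up)"
      by (rule infdist_le) (rule assms(2)[OF that assms(3)])
    also have "\<dots> = dist (x + (r * c) *\<^sub>R up) q"
      by (simp add: dist_norm algebra_simps)
    finally show ?thesis .
  qed
  then show ?thesis
    unfolding infdist_notempty[OF assms(1), of "x + (r * c) *\<^sub>R up"]
    by (rule cINF_greatest[OF assms(1)])
qed

text \<open>The set is the sum of the compact \<open>A\<close> and a closed vertical ray. It is the
  upper shadow of \<open>A\<close> for \<open>c = 1\<close> and the lower one for
  \<open>c = -1\<close>.\<close>

lemma closed_shift_along_up: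
  assumes "compact A" and nz: "c \<noteq> 0"
  shows "closed {a + (r * c) *\<^sub>R up | a r. a \<in> A \<and> (0::real) \<le> r}"
proof -
  have "closed ((\<lambda>r. (r * c) *\<^sub>R up) ` {0::real..})"
  proof -
    have "(\<lambda>r. (r * c) *\<^sub>R up) ` {0::real..} = {y. fst y = 0 \<and> fst (snd y) = 0 \<and> 0 \<le> height y / c}"
    proof (intro equalityI subsetI)
      fix y assume "y \<in> {y. fst y = 0 \<and> fst (snd y) = 0 \<and> 0 \<le> height y / c}"
      then show "y \<in> (\<lambda>r. (r * c) *\<^sub>R up) ` {0::real..}"
        using nz by (intro image_eqI[of _ _ "height y / c"]) (auto simp: up_def height_def prod_eq_iff)
    qed (use nz in \<open>auto simp: up_def height_def\<close>)
    also have "closed \<dots>"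
      unfolding height_def by (intro closed_Collect_conj closed_Collect_eq closed_Collect_le continuous_intros) (use nz in auto)
    finally show ?thesis .
  qed
  from compact_closed_sums[OF assms(1) this]
  show ?thesis by (rule back_subst[of closed]) auto
qed

text \<open>The quotient of distances to the lower shadow of \<open>B\<close> and the upper shadow of \<open>A\<close>: closing
  both sets off vertically is what makes the Urysohn function monotone in the height.\<close>
lemma monotone_Urysohn:
  assumes "compact A" "compact B" "A \<noteq> {}" "B \<noteq> {}"
    and above: "\<And>a b. a \<in> A \<Longrightarrow> b \<in> B \<Longrightarrow> proj a = proj b \<Longrightarrow> height b < height a"
  obtains s :: "pt \<Rightarrow> real" where "continuous_on UNIV s" "\<And>x. 0 \<le> s x" "\<And>x. s x \<le> 1"
    "\<And>x. x \<in> A \<Longrightarrow> s x = 1" "\<And>x. x \<in> B \<Longrightarrow> s x = 0"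
    "\<And>x r. 0 \<le> r \<Longrightarrow> s x \<le> s (x + r *\<^sub>R up)"
proof -
  \<comment> \<open>The upper shadow of \<open>A\<close> and the lower shadow of \<open>B\<close>. A
    common point would place a point of \<open>B\<close> at least as high as one of \<open>A\<close>
    on the same vertical line, so they are disjoint.\<close>
  define P where "P = {a + (r * 1) *\<^sub>R up | a r. a \<in> A \<and> (0::real) \<le> r}"
  define Q where "Q = {b + (r * (-1)) *\<^sub>R up | b r. b \<in> B \<and> (0::real) \<le> r}"
  have cl: "closed P" "closed Q"
    unfolding P_def Q_def by (rule closed_shift_along_up; use assms(1,2) in simp)+
  have AP: "A \<subseteq> P"
  proof
    fix x assume "x \<in> A"
    then show "x \<in> P" unfolding P_def by (intro CollectI exI[of _ x] exI[of _ 0]) auto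
  qed
  have BQ: "B \<subseteq> Q"
  proof
    fix x assume "x \<in> B"
    then show "x \<in> Q" unfolding Q_def by (intro CollectI exI[of _ x] exI[of _ 0]) auto
  qed
  have ne: "P \<noteq> {}" "Q \<noteq> {}" using AP BQ assms(3,4) by blast+
  have disj: "P \<inter> Q = {}"
  proof (rule ccontr)
    assume "P \<inter> Q \<noteq> {}"
    then obtain x where "x \<in> P" "x \<in> Q" by blast
    then obtain a b r q where *: "a \<in> A" "b \<in> B" "0 \<le> r" "0 \<le> q"
      "a + (r * 1) *\<^sub>R up = b + (q * (-1)) *\<^sub>R up" unfolding P_def Q_def by blast
    have "b = a + (r + q) *\<^sub>R up" using *(5) by (simp add: algebra_simps)
    then have "proj a = proj b" "height b = height a + (r + q)"
      by (simp_all only: proj_add_up height_add_up)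
    then show False using above[OF *(1,2)] *(3,4) by simp
  qed
  define s where "s = (\<lambda>x. infdist x Q / (infdist x Q + infdist x P))"
  have pos: "0 < infdist x Q + infdist x P" for x
  proof (cases "x \<in> P")
    case True
    then have "x \<notin> Q" using disj by blast
    then show ?thesis
      using infdist_pos_not_in_closed[OF cl(2) ne(2)] infdist_nonneg[of x P] by (simp add: add_pos_nonneg)
  next
    case False
    then show ?thesis
      using infdist_pos_not_in_closed[OF cl(1) ne(1)] infdist_nonneg[of x Q] by (simp add: add_nonneg_pos)
  qed
  show ?thesis
  proof
    show "continuous_on UNIV s"
      unfolding s_def
      by (intro continuous_intros ballI) (use pos in \<open>auto simp: less_imp_neq[symmetric]\<close>)
    show "0 \<le> s x" for x by (simp add: s_def infdist_nonneg)
    show "s x \<le> 1" for x using pos[of x] by (simp add: s_def infdist_nonneg)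
    show "s x = 1" if "x \<in> A" for x
    proof -
      have "infdist x P = 0" using that AP by auto
      then show ?thesis using pos[of x] by (simp add: s_def)
    qed
    show "s x = 0" if "x \<in> B" for x
      using that BQ by (auto simp: s_def)
    show "s x \<le> s (x + r *\<^sub>R up)" if "0 \<le> r" for x r
    proof -
      \<comment> \<open>Moving up brings a point no closer to \<open>Q\<close> and no farther from
        \<open>P\<close>, so the quotient \<open>s\<close> cannot decrease.\<close>
      have "infdist x Q \<le> infdist (x + (r * 1) *\<^sub>R up) Q"
      proof (rule infdist_add_up_mono[OF ne(2) _ that])
        fix p :: real and q assume "q \<in> Q" "0 \<le> p"
        then obtain b t where "b \<in> B" "0 \<le> t" "q = b + (t * -1) *\<^sub>R up" unfolding Q_def by blast
        then show "q - (p * 1) *\<^sub>R up \<in> Q" unfolding Q_def using \<open>0 \<le> p\<close>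
          by (intro CollectI exI[of _ b] exI[of _ "t + p"]) (auto simp: algebra_simps)
      qed
      then have 1: "infdist x Q \<le> infdist (x + r *\<^sub>R up) Q" by simp
      let ?y = "x + r *\<^sub>R up"
      have "infdist ?y P \<le> infdist (?y + (r * (-1)) *\<^sub>R up) P"
      proof (rule infdist_add_up_mono[OF ne(1) _ that])
        fix p :: real and q assume "q \<in> P" "0 \<le> p"
        then obtain b t where "b \<in> A" "0 \<le> t" "q = b + (t * 1) *\<^sub>R up" unfolding P_def by blast
        then show "q - (p * -1) *\<^sub>R up \<in> P" unfolding P_def using \<open>0 \<le> p\<close>
          by (intro CollectI exI[of _ b] exI[of _ "t + p"]) (auto simp: algebra_simps)
      qed
      then have 2: "infdist ?y P \<le> infdist x P" by simp
      have "infdist x Q * infdist ?y P \<le> infdist ?y Q * infdist x P"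
        using 1 2 by (intro mult_mono infdist_nonneg)
      then show ?thesis
        unfolding s_def using pos[of x] pos[of ?y] by (simp add: divide_le_eq le_divide_eq field_simps)
    qed
  qed
qed

text \<open>On each vertical line the map adds a nondecreasing function of the height to the height,
  so it is strictly increasing there, and the intermediate value theorem makes it onto. Invariance
  of domain supplies the continuity of the inverse.\<close>

lemma vertical_lift_homeomorphism:
  fixes s :: "pt \<Rightarrow> real"
  assumes cont: "continuous_on UNIV s" and bds: "\<And>x. 0 \<le> s x" "\<And>x. s x \<le> 1"
    and mono: "\<And>x r. 0 \<le> r \<Longrightarrow> s x \<le> s (x + r *\<^sub>R up)" and "0 \<le> c"
  shows "\<exists>g. homeomorphism UNIV UNIV (\<lambda>x. x + (c * s x) *\<^sub>R up) g"
proof -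
  let ?f = "\<lambda>x. x + (c * s x) *\<^sub>R up"
  have cf: "continuous_on UNIV ?f" by (intro continuous_intros cont)
  have inj: "x = y" if eq: "?f x = ?f y" and le: "height x \<le> height y" for x y
  proof -
    have "y = x + (c * s x - c * s y) *\<^sub>R up" using eq by (simp add: algebra_simps)
    then have "proj x = proj y" by (metis proj_add_up)
    then obtain r where r: "y = x + r *\<^sub>R up" unfolding proj_eq_iff by blast
    then have "0 \<le> r" using le by simp
    have "height (?f x) = height (?f y)" using eq by simp
    then have "c * s x = r + c * s y" using r by simp
    moreover have "c * s x \<le> c * s y" using mono[OF \<open>0 \<le> r\<close>, of x] r \<open>0 \<le> c\<close> by (simp add: mult_left_mono)
    ultimately have "r = 0" using \<open>0 \<le> r\<close> by linarith
    then show ?thesis using r by simp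
  qed
  have "inj ?f"
  proof (rule injI)
    fix x y assume "?f x = ?f y"
    then show "x = y" using inj[of x y] inj[of y x] by (cases "height x \<le> height y") auto
  qed
  moreover have "surj ?f"
  proof (rule surjI)
    fix y
    \<comment> \<open>A zero of \<open>?k\<close> gives a preimage of \<open>y\<close>. It is sought
      between \<open>-c\<close> and \<open>0\<close> because the lift \<open>c * s\<close> lies
      between \<open>0\<close> and \<open>c\<close>.\<close>
    let ?k = "\<lambda>r. r + c * s (y + r *\<^sub>R up)"
    have "continuous_on {-c..0} ?k"
      by (intro continuous_intros continuous_on_compose2[OF cont]) auto
    moreover have "?k (-c) \<le> 0" "0 \<le> ?k 0"
      using bds \<open>0 \<le> c\<close> mult_left_mono[OF bds(2) \<open>0 \<le> c\<close>] by auto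
    ultimately obtain r where "?k r = 0" using IVT'[of ?k "-c" 0 0] \<open>0 \<le> c\<close> by auto
    then have "?f (y + r *\<^sub>R up) = y" by (simp add: add.assoc flip: scaleR_add_left)
    then show "?f (SOME x. ?f x = y) = y" by (rule someI)
  qed
  ultimately show ?thesis
    using invariance_of_domain_homeomorphism[OF open_UNIV cf] by auto
qed

text \<open>The shear leaves heights unchanged, so the same displacement can be subtracted
  again.\<close>

lemma horizontal_shear_homeomorphism:
  fixes c :: "real \<Rightarrow> real"
  assumes "continuous_on UNIV c"
  shows "homeomorphism UNIV UNIV (\<lambda>x. x + (c (height x), 0, 0)) (\<lambda>x. x - (c (height x), 0, 0))"
proof (rule homeomorphismI)
  have "continuous_on UNIV (\<lambda>x. c (height x))"
    by (rule continuous_on_compose2[OF assms]) (auto simp: height_def intro!: continuous_intros)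
  then show "continuous_on UNIV (\<lambda>x. x + (c (height x), 0::real, 0::real))"
    "continuous_on UNIV (\<lambda>x. x - (c (height x), 0::real, 0::real))"
    by (auto intro!: continuous_intros)
qed (auto simp: height_def)

text \<open>The map lifts \<open>A\<close> above everything and then pushes the space at large
  height sideways. On \<open>A\<close> the outcome is one translation, which will keep segments
  straight and crossings within \<open>A\<close> intact.\<close>

lemma separate_above:
  assumes "compact A" "compact B" "A \<noteq> {}" "B \<noteq> {}"
    and above: "\<And>a b. a \<in> A \<Longrightarrow> b \<in> B \<Longrightarrow> proj a = proj b \<Longrightarrow> height b < height a"
  obtains h g v where "homeomorphism UNIV UNIV h g"
    "\<And>x. x \<in> A \<Longrightarrow> h x = x + v" "\<And>x. x \<in> B \<Longrightarrow> h x = x"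
    "\<And>a b. a \<in> A \<Longrightarrow> b \<in> B \<Longrightarrow> proj (a + v) \<noteq> proj b"
    "ambient_isotopic (A \<union> B) (h ` (A \<union> B))"
proof -
  obtain s :: "pt \<Rightarrow> real" where s: "continuous_on UNIV s" "\<And>x. 0 \<le> s x" "\<And>x. s x \<le> 1"
    "\<And>x. x \<in> A \<Longrightarrow> s x = 1" "\<And>x. x \<in> B \<Longrightarrow> s x = 0"
    "\<And>x r. 0 \<le> r \<Longrightarrow> s x \<le> s (x + r *\<^sub>R up)"
    by (rule monotone_Urysohn[OF assms(1-4)], erule (2) above, rule that, assumption+)
  have "bounded (A \<union> B)" using assms(1,2) by (simp add: compact_imp_bounded)
  from this[unfolded bounded_pos]
  obtain R where R: "R > 0" "\<And>x. x \<in> A \<union> B \<Longrightarrow> norm x \<le> R"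
    by blast
  have ht: "\<bar>height x\<bar> \<le> R" and ab: "\<bar>fst x\<bar> \<le> R" if "x \<in> A \<union> B" for x
  proof -
    have "norm (fst x) \<le> norm x" "norm (snd x) \<le> norm x" "norm (snd (snd x)) \<le> norm (snd x)"
      using norm_fst_le[of "fst x" "snd x"] norm_snd_le[of "snd x" "fst x"]
        norm_snd_le[of "snd (snd x)" "fst (snd x)"] by simp_all
    then show "\<bar>height x\<bar> \<le> R" "\<bar>fst x\<bar> \<le> R" using R(2)[OF that] by (auto simp: height_def)
  qed
  \<comment> \<open>A cutoff that vanishes up to height \<open>R\<close> and equals \<open>1\<close>
    from height \<open>R + 1\<close> on. Lifting by \<open>M\<close> takes the heights of
    \<open>A\<close>, at least \<open>-R\<close>, to at least \<open>R + 1\<close>; the push by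
    \<open>N\<close> exceeds \<open>2 * R\<close>, the largest possible difference of first
    coordinates.\<close>
  define c :: "real \<Rightarrow> real" where "c = (\<lambda>z. max 0 (min 1 (z - R)))"
  have cc: "continuous_on UNIV c" unfolding c_def by (intro continuous_intros)
  define M where "M = 2 * R + 1"
  define N where "N = 2 * R + 1"
  have M: "0 \<le> M" using R(1) by (simp add: M_def)
  \<comment> \<open>Time \<open>t\<close> scales both the lift \<open>J\<close> and the shear that
    follows it. The shear looks at the height after lifting, so that at time 1 it moves
    \<open>A\<close> but not \<open>B\<close>.\<close>
  define J where "J = (\<lambda>z::real \<times> pt. snd z + (fst z * M * s (snd z)) *\<^sub>R up)"
  define H where "H = (\<lambda>z::real \<times> pt. J z + (fst z * N * c (height (J z)), 0, 0))"
  have cJ: "continuous_on UNIV J"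
    unfolding J_def by (intro continuous_intros continuous_on_compose2[OF s(1)] subset_UNIV)
  have cH: "continuous_on UNIV H"
    unfolding H_def height_def
    by (intro continuous_intros cJ continuous_on_compose2[OF cc] subset_UNIV)
  have hom: "\<exists>g. homeomorphism UNIV UNIV (\<lambda>x. H (t, x)) g" if t: "0 \<le> t" for t
  proof -
    have "0 \<le> t * M" using M t by simp
    from vertical_lift_homeomorphism[OF s(1-3,6) this]
    obtain g where g: "homeomorphism UNIV UNIV (\<lambda>x. J (t, x)) g"
      unfolding J_def fst_conv snd_conv by (rule exE)
    have "continuous_on UNIV (\<lambda>z. t * N * c z)" by (intro continuous_intros cc)
    from homeomorphism_compose[OF g horizontal_shear_homeomorphism[OF this]]
    show ?thesis unfolding H_def o_def fst_conv
      by (rule exI[of _ "\<lambda>x. g (x - (t * N * c (height x), 0, 0))"])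
  qed
  define v where "v = (N, 0, 0) + M *\<^sub>R up"
  have hA: "H (1, x) = x + v" if "x \<in> A" for x
  proof -
    have "c (height x + M) = 1" using ht[of x] that by (auto simp: c_def M_def)
    then show ?thesis using s(4)[OF that] by (simp add: H_def J_def v_def algebra_simps)
  qed
  have hB: "H (1, x) = x" if "x \<in> B" for x
  proof -
    have "c (height x) = 0" using ht[of x] that by (auto simp: c_def)
    then show ?thesis using s(5)[OF that] by (simp add: H_def J_def zero_prod_def[symmetric])
  qed
  obtain g where g: "homeomorphism UNIV UNIV (\<lambda>x. H (1, x)) g"
    using hom[OF zero_le_one] by (rule exE)
  have off: "proj (a + v) \<noteq> proj b" if "a \<in> A" "b \<in> B" for a b
  proof
    assume "proj (a + v) = proj b"
    then have "fst a + N = fst b" by (simp add: proj_def v_def up_def)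
    then show False using ab[of a] ab[of b] that R(1) by (simp add: N_def)
  qed
  have H0: "H (0, x) = x" for x by (simp add: H_def J_def zero_prod_def[symmetric])
  have iso: "ambient_isotopic (A \<union> B) ((\<lambda>x. H (1, x)) ` (A \<union> B))"
    unfolding ambient_isotopic_def
  proof (intro exI[of _ H] conjI ballI allI)
    show "continuous_on ({0..1} \<times> UNIV) H" by (rule continuous_on_subset[OF cH subset_UNIV])
    show "\<exists>g. homeomorphism UNIV UNIV (\<lambda>x. H (t, x)) g" if "t \<in> {0..1}" for t
      by (rule hom) (use that in simp)
  qed (rule H0 refl)+
  show thesis
    by (rule that[OF g _ _ _ iso]) (erule hA, erule hB, erule (1) off)
qed

subsection \<open>Arcs of diagrams\<close>

text \<open>Otherwise three distinct points of \<open>D\<close> would share a projection. Over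
  points thus lie on arcs.\<close>

lemma regular_position_over_not_under:
  assumes "regular_position D" "u \<in> D" "w \<in> D" "proj w = proj u" "height u < height w"
  shows "w \<notin> under_points D"
proof
  assume "w \<in> under_points D"
  then obtain z where "z \<in> D" "proj z = proj w" "height w < height z"
    unfolding under_points_def by blast
  moreover have "\<forall>x\<in>D. \<forall>y\<in>D. \<forall>z\<in>D. proj x = proj y \<and> proj y = proj z \<longrightarrow> x = y \<or> y = z \<or> x = z"
    using assms(1) unfolding regular_position_def by blast
  ultimately have "u = w \<or> w = z \<or> u = z"
    using assms(2-4) by metis
  then show False using \<open>height w < height z\<close> assms(5) by auto
qed

text \<open>Of two under points with one projection the higher would be an over point, so
  \<open>proj\<close> is injective on them; their images are double points.\<close>

lemma regular_position_finite_under_points: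
  assumes "regular_position D"
  shows "finite (under_points D)"
proof (rule inj_on_finite)
  show "inj_on proj (under_points D)"
  proof (rule inj_onI, rule ccontr)
    fix x y assume xy: "x \<in> under_points D" "y \<in> under_points D" "proj x = proj y" "x \<noteq> y"
    have D: "x \<in> D" "y \<in> D" using xy unfolding under_points_def by auto
    have "height x \<noteq> height y"
      using xy(3,4) by (auto simp: proj_def height_def prod_eq_iff)
    then show False
      using regular_position_over_not_under[OF assms, of x y]
        regular_position_over_not_under[OF assms, of y x] xy D by fastforce
  qed
  show "proj ` under_points D \<subseteq> double_points D"
  proof
    fix p assume "p \<in> proj ` under_points D"
    then obtain u w where "p = proj u" "u \<in> D" "w \<in> D" "proj w = proj u" "height u < height w"
      unfolding under_points_def by blast
    moreover from this have "w \<noteq> u" by blast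
    ultimately show "p \<in> double_points D" unfolding double_points_def by blast
  qed
  show "finite (double_points D)" using assms unfolding regular_position_def by blast
qed

lemma polygonal_link_segments:
  assumes "polygonal_link D"
  obtains S where "finite S" "D = (\<Union>(a, b)\<in>S. closed_segment a b)"
  using assms unfolding polygonal_link_def by blast

lemma polygonal_link_compact:
  assumes "polygonal_link D"
  shows "compact D"
proof -
  obtain S where S: "finite S" "D = (\<Union>(a, b)\<in>S. closed_segment a b)"
    using polygonal_link_segments[OF assms] .
  show ?thesis unfolding S(2) using S(1) by (intro compact_UN) auto
qed

lemma regular_position_polygonal: "regular_position D \<Longrightarrow> polygonal_link D"
  unfolding regular_position_def by blast

lemma regular_position_finite_arcs:
  assumes "regular_position D"
  shows "finite (arcs D)"
proof -
  obtain S where S: "finite S" "D = (\<Union>(a, b)\<in>S. closed_segment a b)"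
    using polygonal_link_segments[OF regular_position_polygonal[OF assms]] .
  show ?thesis
    unfolding arcs_def using finite_components_segments_diff_finite[OF S(1)
        regular_position_finite_under_points[OF assms]] S(2) by simp
qed

lemma arc_containing:
  assumes "x \<in> D" "x \<notin> under_points D"
  shows "\<exists>X\<in>arcs D. x \<in> X"
  using Union_components[of "D - under_points D"] assms unfolding arcs_def by blast

lemma zcoloringE:
  assumes "zcoloring D \<gamma>" "u \<in> D" "w \<in> D" "proj w = proj u" "height u < height w"
  obtains a b c where "a \<in> arcs D" "w \<in> a" "{X \<in> arcs D. u \<in> closure X} = {b, c}"
    "2 * \<gamma> a = \<gamma> b + \<gamma> c" "b \<in> arcs D" "c \<in> arcs D"
proof -
  have "\<exists>a\<in>arcs D. w \<in> a \<and> (\<exists>b c. {X \<in> arcs D. u \<in> closure X} = {b, c} \<and> 2 * \<gamma> a = \<gamma> b + \<gamma> c)"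
    using assms(1)[unfolded zcoloring_def, rule_format, OF assms(2,3) conjI[OF assms(4,5)]] .
  then obtain a b c where a: "a \<in> arcs D" "w \<in> a"
    and bc: "{X \<in> arcs D. u \<in> closure X} = {b, c}" and eq: "2 * \<gamma> a = \<gamma> b + \<gamma> c"
    by (elim bexE conjE exE) (rule that)
  have "b \<in> {X \<in> arcs D. u \<in> closure X}" "c \<in> {X \<in> arcs D. u \<in> closure X}"
    unfolding bc by simp_all
  then show thesis using that[OF a bc eq] by simp
qed

lemma proj_add: "proj (x + y) = proj x + proj y"
  by (simp add: proj_def)

lemma height_add: "height (x + y) = height x + height y"
  by (simp add: height_def)

text \<open>A segment is connected, so it lies in one of the disjoint closed sets \<open>A\<close>
  and \<open>B\<close>, and on these \<open>h\<close> is a translation and the identity,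
  respectively.\<close>

lemma segments_image:
  fixes h :: "'a::real_normed_vector \<Rightarrow> 'a"
  assumes "finite S" "D = (\<Union>(a, b)\<in>S. closed_segment a b)"
    and "D = A \<union> B" "closed A" "closed B" "A \<inter> B = {}"
    and hA: "\<And>x. x \<in> A \<Longrightarrow> h x = x + v" and hB: "\<And>x. x \<in> B \<Longrightarrow> h x = x"
  shows "h ` D = (\<Union>(a, b)\<in>(\<lambda>(a, b). (h a, h b)) ` S. closed_segment a b)"
proof -
  have "h ` closed_segment a b = closed_segment (h a) (h b)" if ab: "(a, b) \<in> S" for a b
  proof -
    have sub: "closed_segment a b \<subseteq> A \<union> B" using ab assms(2,3) by blast
    have "A \<inter> closed_segment a b = {} \<or> B \<inter> closed_segment a b = {}"
      using connected_closedD[OF connected_segment(1)[of a b], of A B] sub assms(4-6) by blast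
    then consider "closed_segment a b \<subseteq> A" | "closed_segment a b \<subseteq> B" using sub by blast
    then show ?thesis
    proof cases
      case 1
      then have "h ` closed_segment a b = (\<lambda>x. v + x) ` closed_segment a b"
        using hA by (intro image_cong) (auto simp: add.commute)
      moreover have "h a = v + a" "h b = v + b" using 1 hA by (auto simp: add.commute)
      ultimately show ?thesis by (simp only: closed_segment_translation)
    next
      case 2
      then have "h ` closed_segment a b = (\<lambda>x. x) ` closed_segment a b"
        using hB by (intro image_cong) auto
      moreover have "h a = a" "h b = b" using 2 hB by auto
      ultimately show ?thesis by simp
    qed
  qed
  then have "(\<Union>s\<in>S. h ` (case s of (a, b) \<Rightarrow> closed_segment a b)) =
      (\<Union>s\<in>S. case s of (a, b) \<Rightarrow> closed_segment (h a) (h b))"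
    by (intro SUP_cong) auto
  then show ?thesis unfolding assms(2) image_UN by (simp add: image_image case_prod_unfold)
qed

text \<open>Moving \<open>A\<close> aside removes all crossings between the two sublinks, and then
  coloring one sublink \<open>1\<close> and the other \<open>0\<close> satisfies the relation at
  each crossing.\<close>

lemma split_link_two_coloring:
  assumes reg: "regular_position D" and zc: "zcoloring D \<gamma>"
    and D: "D = A \<union> B" "closed A" "closed B" "A \<inter> B = {}" "A \<noteq> {}" "B \<noteq> {}"
    and above: "\<And>a b. a \<in> A \<Longrightarrow> b \<in> B \<Longrightarrow> proj a = proj b \<Longrightarrow> height b < height a"
  shows "\<exists>D' \<gamma>'. regular_position D' \<and> ambient_isotopic D D' \<and> zcoloring D' \<gamma>' \<and>
    nontrivial_coloring D' \<gamma>' \<and> card (\<gamma>' ` arcs D') \<le> 2"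
proof -
  have cD: "compact D" using polygonal_link_compact[OF regular_position_polygonal[OF reg]] .
  have cAB: "compact A" "compact B"
    using cD D(1) compact_Int_closed[OF cD D(2)] compact_Int_closed[OF cD D(3)]
    by (simp_all add: Int_absorb1)
  obtain h g v where hg: "homeomorphism UNIV UNIV h g"
    and hA: "\<And>x. x \<in> A \<Longrightarrow> h x = x + v" and hB: "\<And>x. x \<in> B \<Longrightarrow> h x = x"
    and off: "\<And>a b. a \<in> A \<Longrightarrow> b \<in> B \<Longrightarrow> proj (a + v) \<noteq> proj b"
    and iso: "ambient_isotopic (A \<union> B) (h ` (A \<union> B))"
    by (rule separate_above[OF cAB D(5,6)], erule (2) above, rule that, assumption+)
  have inj: "inj h" using hg by (metis UNIV_I homeomorphism_def injI)
  define D' where "D' = h ` D"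
  define A' where "A' = h ` A"
  define B' where "B' = h ` B"
  have D': "D' = A' \<union> B'" "A' \<inter> B' = {}"
    unfolding D'_def A'_def B'_def using D(1,4) inj by (auto simp: inj_eq)
  have cont: "continuous_on X h" for X
    using homeomorphism_cont1[OF hg] continuous_on_subset by blast
  have clAB': "closed A'" "closed B'"
    unfolding A'_def B'_def using cAB cont compact_continuous_image compact_imp_closed by blast+
  \<comment> \<open>Every coincidence of projections after the move comes from one before it, inside
    a single sublink and with the same order of heights. Regular position and the crossings of
    \<open>D'\<close> are read off from this.\<close>
  have same: "(x \<in> A \<longleftrightarrow> y \<in> A) \<and> proj x = proj y \<and> (height (h x) < height (h y) \<longleftrightarrow> height x < height y)"
    if "x \<in> D" "y \<in> D" "proj (h x) = proj (h y)" for x y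
  proof (cases "x \<in> A")
    case True
    then have "y \<notin> B" using off[of x y] that(3) hA[of x] hB[of y] by auto
    then have "y \<in> A" using that(2) D(1) by blast
    then show ?thesis using True that(3) hA by (simp add: proj_add height_add)
  next
    case False
    then have xB: "x \<in> B" using that(1) D(1) by blast
    then have "y \<notin> A" using off[of y x] that(3) hA[of y] hB[of x] by auto
    then have "y \<in> B" using that(2) D(1) by blast
    then show ?thesis using xB \<open>y \<notin> A\<close> False that(3) hB by simp
  qed

  have poly: "polygonal_link D'"
    unfolding polygonal_link_def
  proof (intro conjI ballI)
    show "D' \<noteq> {}" unfolding D'_def using D(1,5) by blast
    obtain S where S: "finite S" "D = (\<Union>(a, b)\<in>S. closed_segment a b)"
      using polygonal_link_segments[OF regular_position_polygonal[OF reg]] .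
    show "\<exists>S. finite S \<and> D' = (\<Union>(a, b)\<in>S. closed_segment a b)"
      unfolding D'_def using segments_image[OF S D(1-4) hA hB] S(1)
      by (intro exI[of _ "(\<lambda>(a, b). (h a, h b)) ` S"] conjI finite_imageI)
    fix C assume "C \<in> components D'"
    then obtain C0 where C0: "C0 \<in> components D" "C = h ` C0"
      unfolding D'_def components_homeomorphic_image[OF hg] by blast
    have "homeomorphism C0 C h g"
      unfolding C0(2) by (rule homeomorphism_of_subsets[OF hg]) auto
    then have "C homeomorphic C0" using homeomorphic_def homeomorphic_sym by blast
    moreover have "C0 homeomorphic sphere (0::complex) 1"
      using regular_position_polygonal[OF reg] C0(1) unfolding polygonal_link_def by blast
    ultimately show "C homeomorphic sphere (0::complex) 1" by (rule homeomorphic_trans)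
  qed
  have reg': "regular_position D'"
    unfolding regular_position_def
  proof (intro conjI)
    show "polygonal_link D'" by (rule poly)
    have three: "\<forall>x\<in>D. \<forall>y\<in>D. \<forall>z\<in>D. proj x = proj y \<and> proj y = proj z \<longrightarrow> x = y \<or> y = z \<or> x = z"
      and fin: "finite (double_points D)"
      using reg unfolding regular_position_def by blast+
    show "\<forall>x\<in>D'. \<forall>y\<in>D'. \<forall>z\<in>D'. proj x = proj y \<and> proj y = proj z \<longrightarrow> x = y \<or> y = z \<or> x = z"
      unfolding D'_def
    proof (intro ballI impI, elim imageE conjE)
      fix x y z x' y' z'
      assume *: "proj x = proj y" "proj y = proj z" "x = h x'" "y = h y'" "z = h z'"
        "x' \<in> D" "y' \<in> D" "z' \<in> D"
      then have "proj x' = proj y'" "proj y' = proj z'"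
        using same[of x' y'] same[of y' z'] by simp_all
      then have "x' = y' \<or> y' = z' \<or> x' = z'" using three *(6-8) by blast
      then show "x = y \<or> y = z \<or> x = z" using * by blast
    qed
    have "double_points D' \<subseteq> double_points D \<union> (\<lambda>p. p + proj v) ` double_points D"
    proof
      fix p assume "p \<in> double_points D'"
      then obtain x y where xy: "x \<in> D" "y \<in> D" "h y \<noteq> h x" "proj (h y) = proj (h x)" "p = proj (h x)"
        unfolding double_points_def D'_def by blast
      then have "proj y = proj x" "y \<noteq> x" using same[of y x] by auto
      then have dp: "proj x \<in> double_points D" using xy unfolding double_points_def by blast
      show "p \<in> double_points D \<union> (\<lambda>p. p + proj v) ` double_points D"
      proof (cases "x \<in> A")
        case True
        then have "p = proj x + proj v" using xy(5) hA by (simp add: proj_add)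
        then show ?thesis using dp by blast
      next
        case False
        then have "p = proj x" using xy(1,5) hB D(1) by simp
        then show ?thesis using dp by blast
      qed
    qed
    then show "finite (double_points D')" using fin by (meson finite_UnI finite_imageI finite_subset)
    obtain S where S: "finite S" "D = (\<Union>(a, b)\<in>S. closed_segment a b)"
      and SV: "\<forall>(a, b)\<in>S. \<forall>x\<in>D. (proj x = proj a \<longrightarrow> x = a) \<and> (proj x = proj b \<longrightarrow> x = b)"
      using reg unfolding regular_position_def by blast
    show "\<exists>S. finite S \<and> D' = (\<Union>(a, b)\<in>S. closed_segment a b) \<and>
        (\<forall>(a, b)\<in>S. \<forall>x\<in>D'. (proj x = proj a \<longrightarrow> x = a) \<and> (proj x = proj b \<longrightarrow> x = b))"
    proof (intro exI[of _ "(\<lambda>(a, b). (h a, h b)) ` S"] conjI)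
      show "finite ((\<lambda>(a, b). (h a, h b)) ` S)" using S(1) by simp
      show "D' = (\<Union>(a, b)\<in>(\<lambda>(a, b). (h a, h b)) ` S. closed_segment a b)"
        unfolding D'_def by (rule segments_image[OF S D(1-4) hA hB])
      have "proj (h x) = proj (h a) \<longrightarrow> h x = h a" "proj (h x) = proj (h b) \<longrightarrow> h x = h b"
        if "(a, b) \<in> S" "x \<in> D" for a b x
      proof -
        have ab: "a \<in> D" "b \<in> D" using that(1) unfolding S(2) by auto
        have "(proj x = proj a \<longrightarrow> x = a) \<and> (proj x = proj b \<longrightarrow> x = b)"
          using SV that by blast
        then show "proj (h x) = proj (h a) \<longrightarrow> h x = h a" "proj (h x) = proj (h b) \<longrightarrow> h x = h b"
          using same[OF that(2) ab(1)] same[OF that(2) ab(2)] by auto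
      qed
      then show "\<forall>(a, b)\<in>(\<lambda>(a, b). (h a, h b)) ` S. \<forall>x\<in>D'. (proj x = proj a \<longrightarrow> x = a) \<and> (proj x = proj b \<longrightarrow> x = b)"
        unfolding D'_def by auto
    qed
  qed

  \<comment> \<open>The under points that survive the move. Those where \<open>B\<close> passed
    under \<open>A\<close> are under points no longer, so the arcs of \<open>D'\<close> are images
    of components of \<open>D\<close> with possibly fewer points deleted.\<close>
  define U0 where "U0 = {x \<in> D. h x \<in> under_points D'}"
  have U': "under_points D' = h ` U0"
  proof -
    have "under_points D' \<subseteq> h ` D" unfolding D'_def under_points_def by blast
    then show ?thesis unfolding U0_def by blast
  qed
  have U0: "U0 \<subseteq> under_points D"
  proof
    fix x assume "x \<in> U0"
    then obtain w where "x \<in> D" "w \<in> D" "proj (h w) = proj (h x)" "height (h x) < height (h w)"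
      unfolding U0_def under_points_def D'_def by blast
    then show "x \<in> under_points D" unfolding under_points_def using same[of x w] by auto
  qed
  have arcs': "arcs D' = (`) h ` components (D - U0)"
  proof -
    have "D' - under_points D' = h ` D - h ` U0" by (simp only: U') (simp only: D'_def)
    also have "\<dots> = h ` (D - U0)" by (rule image_set_diff[OF inj, symmetric])
    finally have "D' - under_points D' = h ` (D - U0)" .
    then show ?thesis unfolding arcs_def by (simp only: components_homeomorphic_image[OF hg])
  qed
  have side: "X \<subseteq> A' \<or> X \<subseteq> B'" if X: "X \<in> arcs D'" for X
  proof -
    have "connected X" "X \<subseteq> A' \<union> B'"
      using in_components_connected[OF X[unfolded arcs_def]] in_components_subset[OF X[unfolded arcs_def]]
        D'(1) by blast+
    then show ?thesis using connected_closedD[of X A' B'] clAB' D'(2) by blast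
  qed
  have ne: "X \<noteq> {}" if "X \<in> arcs D'" for X
    using that unfolding arcs_def by (rule in_components_nonempty)
  have sideA: "X \<subseteq> A'" if "X \<in> arcs D'" "x \<in> closure X" "x \<in> A'" for X x
    using side[OF that(1)] that(2,3) closure_minimal[OF _ clAB'(2)] D'(2) by blast
  have sideB: "X \<subseteq> B'" if "X \<in> arcs D'" "x \<in> closure X" "x \<in> B'" for X x
    using side[OF that(1)] that(2,3) closure_minimal[OF _ clAB'(1)] D'(2) by blast
  have samepiece: "y \<in> A' \<longleftrightarrow> x \<in> A'" if xy: "x \<in> D'" "y \<in> D'" "proj y = proj x" for x y
  proof -
    obtain x0 y0 where "x0 \<in> D" "y0 \<in> D" "x = h x0" "y = h y0"
      using xy unfolding D'_def by blast
    then show ?thesis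
      using same[of y0 x0] xy(3) by (simp add: A'_def inj_image_mem_iff[OF inj])
  qed
  define \<delta> :: "pt set \<Rightarrow> int" where "\<delta> = (\<lambda>X. if X \<subseteq> B' then 0 else 1)"
  have \<delta>A: "\<delta> X = 1" if "X \<in> arcs D'" "x \<in> closure X" "x \<in> A'" for X x
    using sideA[OF that] ne[OF that(1)] D'(2) unfolding \<delta>_def by auto
  have \<delta>B: "\<delta> X = 0" if "X \<in> arcs D'" "x \<in> closure X" "x \<in> B'" for X x
    using sideB[OF that] unfolding \<delta>_def by auto
  have "zcoloring D' \<delta>"
    unfolding zcoloring_def
  proof (intro ballI impI, elim conjE)
    fix u' w' assume u': "u' \<in> D'" and w': "w' \<in> D'" and pr: "proj w' = proj u'"
      and ht: "height u' < height w'"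
    obtain u w where u: "u \<in> D" "u' = h u" and w: "w \<in> D" "w' = h w"
      using u' w' unfolding D'_def by blast
    have uw: "proj w = proj u" "height u < height w"
      using same[OF u(1) w(1)] pr ht unfolding u(2) w(2) by simp_all
    have uU0: "u \<in> U0" unfolding U0_def under_points_def using u u' w' pr ht by blast
    \<comment> \<open>That at most two arcs end at \<open>u\<close> is taken from the coloring
      \<open>\<gamma>\<close> of \<open>D\<close>; refilling the vanished under points preserves it,
      and \<open>h\<close> carries it to \<open>D'\<close>.\<close>
    obtain b c where bc: "{X \<in> components (D - under_points D). u \<in> closure X} = {b, c}"
      by (rule zcoloringE[OF zc u(1) w(1) uw]) (use that in \<open>simp only: arcs_def\<close>)
    obtain b' c' where bc': "{X \<in> components (D - U0). u \<in> closure X} = {b', c'}"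
      using components_adjacent_refill[OF regular_position_finite_under_points[OF reg]
          regular_position_finite_arcs[OF reg, unfolded arcs_def] U0 uU0 bc] by blast
    have "{X \<in> arcs D'. u' \<in> closure X} = (`) h ` {X \<in> components (D - U0). u \<in> closure X}"
    proof -
      have "u' \<in> closure (h ` X) \<longleftrightarrow> u \<in> closure X" for X
        unfolding u(2) homeomorphism_UNIV_closure_image[OF hg] by (rule inj_image_mem_iff[OF inj])
      then show ?thesis unfolding arcs' by blast
    qed
    then have eq: "{X \<in> arcs D'. u' \<in> closure X} = {h ` b', h ` c'}" unfolding bc' by simp
    then have adj: "h ` b' \<in> arcs D'" "u' \<in> closure (h ` b')" "h ` c' \<in> arcs D'" "u' \<in> closure (h ` c')"
      by blast+
    obtain a where a: "a \<in> arcs D'" "w' \<in> a"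
      using arc_containing[OF w' regular_position_over_not_under[OF reg' u' w' pr ht]] by blast
    then have wa: "w' \<in> closure a" using closure_subset by blast
    have "2 * \<delta> a = \<delta> (h ` b') + \<delta> (h ` c')"
    proof (cases "u' \<in> A'")
      case True
      then have "w' \<in> A'" using samepiece[OF u' w' pr] by blast
      then show ?thesis using \<delta>A[OF a(1) wa] \<delta>A[OF adj(1,2) True] \<delta>A[OF adj(3,4) True] by simp
    next
      case False
      then have "u' \<in> B'" "w' \<in> B'" using samepiece[OF u' w' pr] u' w' D'(1) by blast+
      then show ?thesis using \<delta>B[OF a(1) wa] \<delta>B[OF adj(1,2)] \<delta>B[OF adj(3,4)] by simp
    qed
    then show "\<exists>a\<in>arcs D'. w' \<in> a \<and>
        (\<exists>b c. {X \<in> arcs D'. u' \<in> closure X} = {b, c} \<and> 2 * \<delta> a = \<delta> b + \<delta> c)"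
      using a eq by blast
  qed
  moreover have "nontrivial_coloring D' \<delta>"
  proof -
    \<comment> \<open>Both colors must occur on arcs, so each sublink needs a point that is not an
      under point: an under point can be replaced by the point over it, which is in the same
      sublink.\<close>
    have ex: "\<exists>y\<in>D'. (y \<in> A' \<longleftrightarrow> x \<in> A') \<and> y \<notin> under_points D'" if "x \<in> D'" for x
    proof (cases "x \<in> under_points D'")
      case True
      then obtain w where w: "w \<in> D'" "proj w = proj x" "height x < height w"
        unfolding under_points_def by blast
      then show ?thesis
        using samepiece[OF that w(1,2)] regular_position_over_not_under[OF reg' that w] by blast
    qed (use that in blast)
    obtain x1 x2 where x12: "x1 \<in> A'" "x2 \<in> B'" using D(5,6) unfolding A'_def B'_def by blast
    obtain y1 where y1: "y1 \<in> D'" "y1 \<in> A'" "y1 \<notin> under_points D'"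
      using ex[of x1] x12 D'(1) by blast
    obtain y2 where y2: "y2 \<in> D'" "y2 \<in> B'" "y2 \<notin> under_points D'"
      using ex[of x2] x12 D' by blast
    obtain X1 where X1: "X1 \<in> arcs D'" "y1 \<in> X1" using arc_containing[OF y1(1,3)] by blast
    obtain X2 where X2: "X2 \<in> arcs D'" "y2 \<in> X2" using arc_containing[OF y2(1,3)] by blast
    have "\<delta> X1 = 1" using \<delta>A[OF X1(1) _ y1(2)] X1(2) closure_subset by blast
    moreover have "\<delta> X2 = 0" using \<delta>B[OF X2(1) _ y2(2)] X2(2) closure_subset by blast
    ultimately show ?thesis unfolding nontrivial_coloring_def using X1(1) X2(1) by force
  qed
  moreover have "card (\<delta> ` arcs D') \<le> 2"
  proof -
    have "\<delta> ` arcs D' \<subseteq> {0, 1}" unfolding \<delta>_def by auto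
    then have "card (\<delta> ` arcs D') \<le> card {0, 1 :: int}" by (rule card_mono[rotated]) simp
    then show ?thesis by simp
  qed
  moreover have "ambient_isotopic D D'" using iso D(1) unfolding D'_def by simp
  ultimately show ?thesis using reg' by blast
qed

subsection \<open>Color classes\<close>

text \<open>An arc is relatively closed in \<open>D - under_points D\<close>, so within
  \<open>D\<close> its closure can only gain under points.\<close>

lemma arc_closure_non_under:
  assumes "X \<in> arcs D" "x \<in> closure X" "x \<in> D" "x \<notin> under_points D"
  shows "x \<in> X"
proof -
  obtain T where T: "closed T" "X = (D - under_points D) \<inter> T"
    using closedin_component[OF assms(1)[unfolded arcs_def]] unfolding closedin_closed by blast
  then have "closure X \<subseteq> T" by (intro closure_minimal) auto
  then show ?thesis using T(2) assms(2-4) by blast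
qed

text \<open>If no crossing violated the conclusion, the strands with colors in \<open>W\<close> would form a
  sublink lying above the rest of the link.\<close>
lemma color_class_crossing:
  assumes reg: "regular_position D" and zc: "zcoloring D \<gamma>"
    and W: "\<gamma> ` arcs D \<inter> W \<noteq> {}" "\<not> \<gamma> ` arcs D \<subseteq> W"
    and nonsplit: "\<And>D' \<gamma>'. regular_position D' \<Longrightarrow> ambient_isotopic D D' \<Longrightarrow> zcoloring D' \<gamma>' \<Longrightarrow>
      nontrivial_coloring D' \<gamma>' \<Longrightarrow> 2 < card (\<gamma>' ` arcs D')"
  shows "\<exists>a\<in>\<gamma> ` arcs D. \<exists>b\<in>\<gamma> ` arcs D. \<exists>c\<in>\<gamma> ` arcs D.
    2 * a = b + c \<and> b \<in> W \<and> (c \<notin> W \<or> a \<notin> W)"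
proof (rule ccontr)
  assume contra: "\<not> ?thesis"
  have no: "\<gamma> c \<in> W \<and> \<gamma> a \<in> W"
    if "a \<in> arcs D" "b \<in> arcs D" "c \<in> arcs D" "2 * \<gamma> a = \<gamma> b + \<gamma> c" "\<gamma> b \<in> W" for a b c
    using contra that by blast
  have ex: "\<exists>X\<in>arcs D. x \<in> closure X" if x: "x \<in> D" for x
  proof (cases "x \<in> under_points D")
    case True
    then obtain w where w: "w \<in> D" "proj w = proj x" "height x < height w"
      unfolding under_points_def by blast
    obtain b c where "{X \<in> arcs D. x \<in> closure X} = {b, c}" using zcoloringE[OF zc x w] .
    then have "b \<in> {X \<in> arcs D. x \<in> closure X}" by simp
    then show ?thesis by blast
  next
    case False
    then show ?thesis using arc_containing[OF x] closure_subset by blast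
  qed
  \<comment> \<open>Whether the color is in \<open>W\<close> depends only on the point touched: at
    an under point the arcs in question are the under arcs of its crossing, elsewhere there is only
    one arc. This makes the sublinks \<open>A\<close> and \<open>B\<close> below disjoint.\<close>
  have eq: "\<gamma> X \<in> W \<longleftrightarrow> \<gamma> Y \<in> W"
    if X: "X \<in> arcs D" "x \<in> closure X" and Y: "Y \<in> arcs D" "x \<in> closure Y" and x: "x \<in> D" for x X Y
  proof (cases "x \<in> under_points D")
    case True
    then obtain w where w: "w \<in> D" "proj w = proj x" "height x < height w"
      unfolding under_points_def by blast
    obtain a b c where *: "a \<in> arcs D" "w \<in> a" "{X \<in> arcs D. x \<in> closure X} = {b, c}"
      "2 * \<gamma> a = \<gamma> b + \<gamma> c" "b \<in> arcs D" "c \<in> arcs D"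
      using zcoloringE[OF zc x w] .
    have "X \<in> {b, c}" "Y \<in> {b, c}" unfolding *(3)[symmetric] using X Y by simp_all
    moreover have "2 * \<gamma> a = \<gamma> c + \<gamma> b" using *(4) by simp
    then have "\<gamma> b \<in> W \<longleftrightarrow> \<gamma> c \<in> W"
      using no[OF *(1,5,6,4)] no[OF *(1,6,5)] by blast
    ultimately show ?thesis by blast
  next
    case False
    then have "x \<in> X" "x \<in> Y" using arc_closure_non_under X Y x by blast+
    then have "X = Y" using X(1) Y(1) components_nonoverlap unfolding arcs_def by blast
    then show ?thesis by simp
  qed
  \<comment> \<open>Taking closures puts back the under points at which the arcs end; a finite union
    of closures is closed.\<close>
  define A where "A = D \<inter> \<Union>(closure ` {X \<in> arcs D. \<gamma> X \<in> W})"
  define B where "B = D \<inter> \<Union>(closure ` {X \<in> arcs D. \<gamma> X \<notin> W})"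
  have fin: "finite (arcs D)" using regular_position_finite_arcs[OF reg] .
  have cD: "closed D"
    using polygonal_link_compact[OF regular_position_polygonal[OF reg]] by (rule compact_imp_closed)
  have "D = A \<union> B" using ex unfolding A_def B_def by blast
  moreover have "closed A" "closed B"
    unfolding A_def B_def using fin cD by (intro closed_Int closed_Union; force)+
  moreover have disj: "A \<inter> B = {}" using eq unfolding A_def B_def by blast
  moreover have nonempty: "D \<inter> closure X \<noteq> {}" if "X \<in> arcs D" for X
    using that in_components_nonempty in_components_subset closure_subset[of X] unfolding arcs_def by blast
  have "A \<noteq> {}" using W(1) nonempty unfolding A_def by blast
  moreover have "B \<noteq> {}" using W(2) nonempty unfolding B_def by blast
  \<comment> \<open>If \<open>y\<close> were above \<open>x\<close>, the under arc \<open>b\<close>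
    at \<open>x\<close> would have its color in \<open>W\<close> and the over arc \<open>a\<close>
    through \<open>y\<close> would not, against \<open>no\<close>.\<close>
  moreover have "height y < height x" if x: "x \<in> A" and y: "y \<in> B" and pr: "proj x = proj y" for x y
  proof (rule ccontr)
    assume "\<not> height y < height x"
    moreover have "x \<noteq> y" using x y disj by blast
    then have "height x \<noteq> height y" using pr by (auto simp: proj_def height_def prod_eq_iff)
    ultimately have "height x < height y" by simp
    moreover have xy: "x \<in> D" "y \<in> D" using x y unfolding A_def B_def by auto
    ultimately obtain a b c where *: "a \<in> arcs D" "y \<in> a" "{X \<in> arcs D. x \<in> closure X} = {b, c}"
      "2 * \<gamma> a = \<gamma> b + \<gamma> c" "b \<in> arcs D" "c \<in> arcs D"
      using zcoloringE[OF zc _ _ pr[symmetric]] by blast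
    have "b \<in> {X \<in> arcs D. x \<in> closure X}" unfolding *(3) by simp
    then have "x \<in> closure b" by simp
    moreover obtain X where X: "X \<in> arcs D" "x \<in> closure X" "\<gamma> X \<in> W" using x unfolding A_def by blast
    ultimately have bW: "\<gamma> b \<in> W" using eq[OF X(1,2) *(5) _ xy(1)] by blast
    have "y \<in> closure a" using *(2) closure_subset by blast
    moreover obtain Y where Y: "Y \<in> arcs D" "y \<in> closure Y" "\<gamma> Y \<notin> W" using y unfolding B_def by blast
    ultimately have "\<gamma> a \<notin> W" using eq[OF Y(1,2) *(1) _ xy(2)] by blast
    then show False using no[OF *(1,5,6,4) bW] by blast
  qed
  ultimately obtain D' \<gamma>' where "regular_position D'" "ambient_isotopic D D'" "zcoloring D' \<gamma>'"
    "nontrivial_coloring D' \<gamma>'" "card (\<gamma>' ` arcs D') \<le> 2"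
    using split_link_two_coloring[OF reg zc, of A B] by auto
  then show False using nonsplit[of D' \<gamma>'] by simp
qed

text \<open>The crossing relation is invariant under affine changes of color; in this direction a
  common factor \<open>k\<close> can be divided out.\<close>

lemma zcoloring_descale:
  assumes "zcoloring D \<gamma>" "k \<noteq> 0" "\<And>X. X \<in> arcs D \<Longrightarrow> \<gamma> X = m + k * \<gamma>' X"
  shows "zcoloring D \<gamma>'"
  unfolding zcoloring_def
proof (intro ballI impI, elim conjE)
  fix u w assume uw: "u \<in> D" "w \<in> D" "proj w = proj u" "height u < height w"
  obtain a b c where *: "a \<in> arcs D" "w \<in> a" "{X \<in> arcs D. u \<in> closure X} = {b, c}"
    "2 * \<gamma> a = \<gamma> b + \<gamma> c" "b \<in> arcs D" "c \<in> arcs D"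
    using zcoloringE[OF assms(1) uw] .
  have "k * (2 * \<gamma>' a) = k * (\<gamma>' b + \<gamma>' c)"
    using *(4) assms(3)[OF *(1)] assms(3)[OF *(5)] assms(3)[OF *(6)] by (simp add: algebra_simps)
  then have "2 * \<gamma>' a = \<gamma>' b + \<gamma>' c" using assms(2) by simp
  then show "\<exists>a\<in>arcs D. w \<in> a \<and> (\<exists>b c. {X \<in> arcs D. u \<in> closure X} = {b, c} \<and> 2 * \<gamma>' a = \<gamma>' b + \<gamma>' c)"
    by (intro bexI[OF _ *(1)] conjI[OF *(2)] exI[of _ b] exI[of _ c] conjI[OF *(3)])
qed

section \<open>The four colors and their normalization\<close>

lemma card_eq_4_sorted:
  fixes V :: "int set"
  assumes "card V = 4"
  obtains p q r s where "V = {p, q, r, s}" "p < q" "q < r" "r < s"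
proof -
  define l where "l = sorted_list_of_set V"
  have fin: "finite V" using assms by (metis card.infinite zero_neq_numeral)
  have l: "length l = 4" "set l = V" "sorted_wrt (<) l"
    using fin assms by (simp_all add: l_def)
  from l(1) obtain p q r s where "l = [p, q, r, s]"
    by (auto simp: numeral_eq_Suc length_Suc_conv)
  then show thesis using that[of p q r s] l(2,3) by auto
qed

theorem theorem3p2:
  fixes K :: "pt set"
  assumes "polygonal_link K"
    and "Z_colorable K"
    and "mincol_Z K = 4"
  shows "\<exists>D \<gamma>. diagram_of K D \<and> zcoloring D \<gamma> \<and> \<gamma> ` arcs D = {0, 1, 2, 3}"
proof -
  let ?P = "\<lambda>n. \<exists>D \<gamma>. diagram_of K D \<and> zcoloring D \<gamma> \<and> nontrivial_coloring D \<gamma> \<and> card (\<gamma> ` arcs D) = n"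
  have "\<exists>n. ?P n" using assms(2) unfolding Z_colorable_def by blast
  then have "?P (mincol_Z K)" unfolding mincol_Z_def by (rule LeastI_ex)
  then obtain D \<gamma> where D: "diagram_of K D" and zc: "zcoloring D \<gamma>" and card: "card (\<gamma> ` arcs D) = 4"
    unfolding assms(3) by blast
  have reg: "regular_position D" and iso: "ambient_isotopic K D" using D unfolding diagram_of_def by auto
  \<comment> \<open>A diagram isotopic to \<open>D\<close> is again a diagram of \<open>K\<close>,
    so by minimality its nontrivial colorings use at least four colors.\<close>
  have nonsplit: "2 < card (\<gamma>' ` arcs D')" if "regular_position D'" "ambient_isotopic D D'"
    "zcoloring D' \<gamma>'" "nontrivial_coloring D' \<gamma>'" for D' \<gamma>'
  proof -
    have "?P (card (\<gamma>' ` arcs D'))"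
      using that ambient_isotopic_trans[OF iso that(2)] unfolding diagram_of_def by blast
    then have "mincol_Z K \<le> card (\<gamma>' ` arcs D')" unfolding mincol_Z_def by (rule Least_le)
    then show ?thesis using assms(3) by simp
  qed
  obtain p q r s where V: "\<gamma> ` arcs D = {p, q, r, s}" and ord: "p < q" "q < r" "r < s"
    using card_eq_4_sorted[OF card] .
  have nontriv: "\<not> \<gamma> ` arcs D \<subseteq> {q}" "\<not> \<gamma> ` arcs D \<subseteq> {r}" unfolding V using ord by auto
  \<comment> \<open>In the relation \<open>2 * a = q + c\<close> the color \<open>a\<close> is
    midway between \<open>q\<close> and \<open>c\<close>. With \<open>c = q\<close> it would be
    \<open>q\<close>, which is excluded; with \<open>c = p\<close> or \<open>c = r\<close> it would
    lie strictly between neighboring colors. Only \<open>c = s\<close> and \<open>a = r\<close>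
    remain.\<close>
  have "s = 2 * r - q"
  proof -
    have "\<gamma> ` arcs D \<inter> {q} \<noteq> {}" unfolding V by blast
    from color_class_crossing[OF reg zc this nontriv(1) nonsplit]
    obtain a b c where "a \<in> {p, q, r, s}" "b \<in> {p, q, r, s}" "c \<in> {p, q, r, s}"
      "2 * a = b + c" "b = q" "c \<noteq> q \<or> a \<noteq> q"
      unfolding V by blast
    then show ?thesis using ord by auto
  qed
  \<comment> \<open>The mirror image: with an under arc of color \<open>r\<close> only
    \<open>c = p\<close> and \<open>a = q\<close> are possible.\<close>
  moreover have "p = 2 * q - r"
  proof -
    have "\<gamma> ` arcs D \<inter> {r} \<noteq> {}" unfolding V by blast
    from color_class_crossing[OF reg zc this nontriv(2) nonsplit]
    obtain a b c where "a \<in> {p, q, r, s}" "b \<in> {p, q, r, s}" "c \<in> {p, q, r, s}"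
      "2 * a = b + c" "b = r" "c \<noteq> r \<or> a \<noteq> r"
      unfolding V by blast
    then show ?thesis using ord by auto
  qed
  moreover define k where "k = r - q"
  ultimately have pqrs: "q = p + k * 1" "r = p + k * 2" "s = p + k * 3" and k: "k \<noteq> 0"
    using ord by auto
  \<comment> \<open>All colors differ from \<open>p\<close> by multiples of the step
    \<open>k\<close>, so the division is exact.\<close>
  define \<delta> where "\<delta> = (\<lambda>X. (\<gamma> X - p) div k)"
  have "\<gamma> X = p + k * \<delta> X" if "X \<in> arcs D" for X
  proof -
    have "\<gamma> X \<in> {p, q, r, s}" using that V by blast
    then have "k dvd \<gamma> X - p" unfolding pqrs by auto
    then show ?thesis unfolding \<delta>_def by simp
  qed
  then have "zcoloring D \<delta>" by (rule zcoloring_descale[OF zc k])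
  moreover have "\<delta> ` arcs D = (\<lambda>x. (x - p) div k) ` \<gamma> ` arcs D"
    unfolding \<delta>_def image_image ..
  then have "\<delta> ` arcs D = {0, 1, 2, 3}"
    unfolding V pqrs using k by simp
  ultimately show ?thesis using D by blast
qed

end
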